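(* Let $\mathbb{k}$ be an algebraically closed field, $n\ge2$, and $V=\mathbb{k}p_n$ the $1$-dimensional homogeneous vector space of degree $n$. For any $C\in\mathcal M_{n-1}$, the $2$-cocycle space $Z_g^2(\mathfrak p(C),V)$ is a subvariety of the affine space $\mathbb{k}^{n-1}$ of dimension not bigger than the number $u(C)$ of generic connected components of the graph $\mathrm{Gr}(C)$.
   Context: $[m]=\{1,\dots,m\}$. $\mathcal M_m$ is the set of $m\times m$ symmetric matrices $C=(c_{ij})_{i,j\in[m]}$ over $\mathbb{k}$ with $c_{ij}=0$ if $i+j>m$ and $c_{jk}c_{i,j+k}=c_{ij}c_{i+j,k}$ for all $i,j,k\ge 1$ (where $c_{ij}$ is read as $0$ whenever $i+j>m$). For $C\in\mathcal M_m$, the diagonally graded commutative algebra $\mathfrak p(C)$ is the $\mathbb N^+$-graded vector space with fixed basis $p_1,\dots,p_m$, $\deg p_i=i$, and multiplication $p_ip_j=c_{ij}p_{i+j}$ (where $p_l=0$ for $l>m$). For $C\in\mathcal M_{n-1}$, $Z_g^2(\mathfrak p(C),V)$ is the space of graded $2$-cocycles: degree-preserving symmetric bilinear maps $\theta:\mathfrak p(C)\times\mathfrak p(C)\to V$ with $\theta(ab,c)=\theta(a,bc)$. Such $\theta$ satisfies $\theta(p_i,p_j)=\delta_{i+j,n}\theta_ip_n$ for scalars $\theta_i$, and is identified with the tuple $(\theta_i)_{i\in[n-1]}\in\mathbb{k}^{n-1}$; thus $$Z_g^2(\mathfrak p(C),V)=\{(\theta_i)_{i\in[n-1]}\in\mathbb{k}^{n-1}\mid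 \theta_i=\theta_{n-i},\ \theta_{i+j}c_{ij}=\theta_{j+k}c_{jk}\ \forall i,j,k\ge1,\ i+j+k=n\}.$$ Graph $\mathrm{Gr}(C)$: the undirected simple graph with vertex set $[n-1]$ in which two distinct vertices $p,q$ are adjacent iff $p+q=n$ or there exist $i,j,k\ge1$ with $i+j+k=n$, $p=i+j$, $q=j+k$, $c_{ij}c_{jk}\ne0$. A connected component of $\mathrm{Gr}(C)$ is called contractible if there exist $i,j\ge1$ such that the component contains the vertex $i+j$, and $c_{ij}\ne0$ but $c_{j,n-i-j}=0$. Otherwise it is called generic. *)

theory Defs
  imports
    "HOL-Computational_Algebra.Polynomial"
    "HOL-Library.Extended_Nat"
begin

section \<open>Coordinate spaces\<close>

text \<open>
  The vector space with basis \<open>p\<^sub>s\<close>, \<open>s \<in> S\<close>, is the set of coordinate functions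
  \<open>nat \<Rightarrow> 'k\<close> that vanish outside \<open>S\<close>.  With \<open>deg p\<^sub>s = s\<close>, its homogeneous component of
  degree \<open>d\<close> is \<open>coord_space (S \<inter> {d})\<close>.  The affine space of dimension \<open>m\<close> is
  \<open>coord_space {1..m}\<close>.
\<close>

definition coord_space :: "nat set \<Rightarrow> (nat \<Rightarrow> 'k::zero) set" where
  "coord_space S = {v. \<forall>i. i \<notin> S \<longrightarrow> v i = 0}"

definition basis_vec :: "nat \<Rightarrow> nat \<Rightarrow> 'k::zero_neq_one" where
  "basis_vec i = (\<lambda>l. if l = i then 1 else 0)"


section \<open>Subvarieties of affine space and their dimension\<close>

inductive_set poly_functions :: "nat \<Rightarrow> ((nat \<Rightarrow> 'k::comm_ring_1) \<Rightarrow> 'k) set" for m :: nat where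
  const: "(\<lambda>x. c) \<in> poly_functions m"
| coord: "i \<in> {1..m} \<Longrightarrow> (\<lambda>x. x i) \<in> poly_functions m"
| add: "f \<in> poly_functions m \<Longrightarrow> g \<in> poly_functions m \<Longrightarrow> (\<lambda>x. f x + g x) \<in> poly_functions m"
| mult: "f \<in> poly_functions m \<Longrightarrow> g \<in> poly_functions m \<Longrightarrow> (\<lambda>x. f x * g x) \<in> poly_functions m"

definition zariski_closed :: "nat \<Rightarrow> (nat \<Rightarrow> 'k::comm_ring_1) set \<Rightarrow> bool" where
  "zariski_closed m X \<longleftrightarrow>
     (\<exists>F \<subseteq> poly_functions m. X = {x \<in> coord_space {1..m}. \<forall>f \<in> F. f x = 0})"

text \<open>Subvarieties are understood to be irreducible; in particular they are nonempty.\<close>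

definition affine_subvariety :: "nat \<Rightarrow> (nat \<Rightarrow> 'k::comm_ring_1) set \<Rightarrow> bool" where
  "affine_subvariety m X \<longleftrightarrow> zariski_closed m X \<and> X \<noteq> {} \<and>
     (\<forall>Y Z. zariski_closed m Y \<longrightarrow> zariski_closed m Z \<longrightarrow> X = Y \<union> Z \<longrightarrow> X = Y \<or> X = Z)"

text \<open>
  The Krull dimension of a nonempty Zariski closed set \<open>X\<close>: the supremum of the lengths \<open>r\<close> of
  chains \<open>Y\<^sub>0 \<subset> Y\<^sub>1 \<subset> \<dots> \<subset> Y\<^sub>r\<close> of irreducible closed subsets of \<open>X\<close>.  As \<open>X\<close> is closed, its
  closed subsets in the subspace topology are those of the affine space that lie in \<open>X\<close>.
\<close>

definition variety_dim :: "nat \<Rightarrow> (nat \<Rightarrow> 'k::comm_ring_1) set \<Rightarrow> enat" where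
  "variety_dim m X =
     Sup {enat r | r. \<exists>Y. (\<forall>i\<le>r. affine_subvariety m (Y i) \<and> Y i \<subseteq> X) \<and>
                          (\<forall>i<r. Y i \<subset> Y (Suc i))}"


section \<open>Diagonally graded commutative algebras\<close>

text \<open>
  A matrix \<open>C\<close> is stored as a function of two indices that is \<open>0\<close> outside \<open>{1..m} \<times> {1..m}\<close>, so
  that \<open>C i j\<close> with \<open>i + j > m\<close> reads as \<open>0\<close> also for indices larger than \<open>m\<close>.
\<close>

definition diag_matrices :: "nat \<Rightarrow> (nat \<Rightarrow> nat \<Rightarrow> 'k::field) set" where
  "diag_matrices m =
     {C. (\<forall>i j. i \<notin> {1..m} \<or> j \<notin> {1..m} \<longrightarrow> C i j = 0) \<and>
         (\<forall>i j. C i j = C j i) \<and>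
         (\<forall>i j. i + j > m \<longrightarrow> C i j = 0) \<and>
         (\<forall>i\<ge>1. \<forall>j\<ge>1. \<forall>k\<ge>1. C j k * C i (j + k) = C i j * C (i + j) k)}"

text \<open>
  The product of \<open>\<pp>(C)\<close> on \<open>coord_space {1..m}\<close>: the bilinear extension of
  \<open>p\<^sub>i p\<^sub>j = c\<^sub>i\<^sub>j p\<^bsub>i+j\<^esub>\<close>, where \<open>p\<^sub>l = 0\<close> for \<open>l > m\<close>; see \<open>diag_mult_basis\<close>.
\<close>

definition diag_mult ::
    "nat \<Rightarrow> (nat \<Rightarrow> nat \<Rightarrow> 'k::field) \<Rightarrow> (nat \<Rightarrow> 'k) \<Rightarrow> (nat \<Rightarrow> 'k) \<Rightarrow> (nat \<Rightarrow> 'k)" where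
  "diag_mult m C a b = (\<lambda>l. if l \<le> m then \<Sum>i=1..<l. C i (l - i) * a i * b (l - i) else 0)"

lemma diag_mult_basis:
  assumes "i \<ge> 1" "j \<ge> 1"
  shows "diag_mult m C (basis_vec i) (basis_vec j) =
           (if i + j \<le> m then (\<lambda>l. C i j * basis_vec (i + j) l) else (\<lambda>l. 0))"
proof
  fix l
  have "(\<Sum>x=1..<l. C x (l - x) * basis_vec i x * basis_vec j (l - x))
      = (\<Sum>x=1..<l. if x = i then C i (l - i) * basis_vec j (l - i) else 0)"
    by (intro sum.cong) (auto simp: basis_vec_def)
  also have "\<dots> = C i j * basis_vec (i + j) l"
    using assms by (auto simp: basis_vec_def)
  finally show "diag_mult m C (basis_vec i) (basis_vec j) l =
           (if i + j \<le> m then (\<lambda>l. C i j * basis_vec (i + j) l) else (\<lambda>l. 0)) l"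
    by (auto simp: diag_mult_def basis_vec_def)
qed


section \<open>Graded 2-cocycles\<close>

text \<open>
  Degree-preserving symmetric bilinear maps \<open>\<theta> : \<pp>(C) \<times> \<pp>(C) \<rightarrow> V\<close> with
  \<open>\<theta>(ab, c) = \<theta>(a, bc)\<close>, for \<open>C\<close> of size \<open>n - 1\<close> and \<open>V = coord_space {n}\<close>.  The values of
  \<open>\<theta>\<close> outside the carrier of \<open>\<pp>(C)\<close> are irrelevant.
\<close>

definition graded_cocycle ::
    "nat \<Rightarrow> (nat \<Rightarrow> nat \<Rightarrow> 'k::field) \<Rightarrow> ((nat \<Rightarrow> 'k) \<Rightarrow> (nat \<Rightarrow> 'k) \<Rightarrow> (nat \<Rightarrow> 'k)) \<Rightarrow> bool" where
  "graded_cocycle n C \<theta> \<longleftrightarrow>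
     (let A = coord_space {1..n-1} in
       (\<forall>a\<in>A. \<forall>b\<in>A. \<theta> a b \<in> coord_space {n}) \<and>
       (\<forall>a\<in>A. \<forall>b\<in>A. \<theta> a b = \<theta> b a) \<and>
       (\<forall>a\<in>A. \<forall>a'\<in>A. \<forall>b\<in>A. \<theta> (\<lambda>l. a l + a' l) b = (\<lambda>l. \<theta> a b l + \<theta> a' b l)) \<and>
       (\<forall>a\<in>A. \<forall>b\<in>A. \<forall>b'\<in>A. \<theta> a (\<lambda>l. b l + b' l) = (\<lambda>l. \<theta> a b l + \<theta> a b' l)) \<and>
       (\<forall>s. \<forall>a\<in>A. \<forall>b\<in>A. \<theta> (\<lambda>l. s * a l) b = (\<lambda>l. s * \<theta> a b l)) \<and>
       (\<forall>s. \<forall>a\<in>A. \<forall>b\<in>A. \<theta> a (\<lambda>l. s * b l) = (\<lambda>l. s * \<theta> a b l)) \<and>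
       (\<forall>i j. \<forall>a\<in>coord_space ({1..n-1} \<inter> {i}). \<forall>b\<in>coord_space ({1..n-1} \<inter> {j}).
           \<theta> a b \<in> coord_space ({n} \<inter> {i + j})) \<and>
       (\<forall>a\<in>A. \<forall>b\<in>A. \<forall>c\<in>A.
           \<theta> (diag_mult (n - 1) C a b) c = \<theta> a (diag_mult (n - 1) C b c)))"

text \<open>The tuple \<open>(\<theta>\<^sub>i)\<close> given by \<open>\<theta>(p\<^sub>i, p\<^bsub>n-i\<^esub>) = \<theta>\<^sub>i p\<^sub>n\<close>.\<close>

definition cocycle_tuple ::
    "nat \<Rightarrow> ((nat \<Rightarrow> 'k::field) \<Rightarrow> (nat \<Rightarrow> 'k) \<Rightarrow> (nat \<Rightarrow> 'k)) \<Rightarrow> nat \<Rightarrow> 'k" where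
  "cocycle_tuple n \<theta> = (\<lambda>i. if i \<in> {1..n-1} then \<theta> (basis_vec i) (basis_vec (n - i)) n else 0)"

definition cocycle_space :: "nat \<Rightarrow> (nat \<Rightarrow> nat \<Rightarrow> 'k::field) \<Rightarrow> (nat \<Rightarrow> 'k) set" where
  "cocycle_space n C = cocycle_tuple n ` {\<theta>. graded_cocycle n C \<theta>}"

lemma basis_vec_mem: "i \<in> S \<Longrightarrow> basis_vec i \<in> coord_space S"
  by (auto simp: basis_vec_def coord_space_def)

lemma graded_cocycle_basis:
  assumes "graded_cocycle n C \<theta>" "i \<in> {1..n-1}" "j \<in> {1..n-1}"
  shows "\<theta> (basis_vec i) (basis_vec j) =
           (if i + j = n then (\<lambda>l. cocycle_tuple n \<theta> i * basis_vec n l) else (\<lambda>l. 0))"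
proof -
  have "\<theta> (basis_vec i) (basis_vec j) \<in> coord_space ({n} \<inter> {i + j})"
    by (rule assms(1)[unfolded graded_cocycle_def Let_def, THEN conjunct2, THEN conjunct2, THEN conjunct2, THEN conjunct2, THEN conjunct2, THEN conjunct2, THEN conjunct1, rule_format])
       (use assms(2,3) in \<open>auto intro!: basis_vec_mem\<close>)
  moreover have "j = n - i" if "i + j = n"
    using that by simp
  ultimately show ?thesis
    using assms by (auto simp: coord_space_def cocycle_tuple_def basis_vec_def fun_eq_iff)
qed

lemma sum_triples_left:
  fixes h :: "nat \<Rightarrow> nat \<Rightarrow> nat \<Rightarrow> 'k::field"
  shows "(\<Sum>m=1..n-1. \<Sum>i=1..<m. h i (m - i) (n - m)) =
         (\<Sum>(i,j,k)\<in>{(i,j,k). i \<ge> 1 \<and> j \<ge> 1 \<and> k \<ge> 1 \<and> i + j + k = n}. h i j k)"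
  by (subst sum.Sigma, simp, simp,
      rule sum.reindex_bij_witness[where j = "\<lambda>(m,i). (i, m - i, n - m)" and i = "\<lambda>(i,j,k). (i + j, i)"])
     auto

lemma sum_triples_right:
  fixes h :: "nat \<Rightarrow> nat \<Rightarrow> nat \<Rightarrow> 'k::field"
  shows "(\<Sum>i=1..n-1. \<Sum>j=1..<n-i. h i j (n - i - j)) =
         (\<Sum>(i,j,k)\<in>{(i,j,k). i \<ge> 1 \<and> j \<ge> 1 \<and> k \<ge> 1 \<and> i + j + k = n}. h i j k)"
  by (subst sum.Sigma, simp, simp,
      rule sum.reindex_bij_witness[where j = "\<lambda>(i,j). (i, j, n - i - j)" and i = "\<lambda>(i,j,k). (i, j)"])
     auto

lemma cocycle_space_eq:
  fixes C :: "nat \<Rightarrow> nat \<Rightarrow> 'k::field"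
  shows "cocycle_space n C =
    {t \<in> coord_space {1..n-1}.
       (\<forall>i\<in>{1..n-1}. t i = t (n - i)) \<and>
       (\<forall>i\<ge>1. \<forall>j\<ge>1. \<forall>k\<ge>1. i + j + k = n \<longrightarrow> t (i + j) * C i j = t (j + k) * C j k)}"
    (is "_ = ?R")
proof (intro equalityI subsetI)
  fix t assume "t \<in> cocycle_space n C"
  then obtain \<theta> where th: "graded_cocycle n C \<theta>" and t: "t = cocycle_tuple n \<theta>"
    by (auto simp: cocycle_space_def)
  let ?A = "coord_space {1..n-1} :: (nat \<Rightarrow> 'k) set"
  have th_sym: "\<And>a b. a \<in> ?A \<Longrightarrow> b \<in> ?A \<Longrightarrow> \<theta> a b = \<theta> b a"
    by (rule th[unfolded graded_cocycle_def Let_def, THEN conjunct2, THEN conjunct1, rule_format])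
  have sym: "t i = t (n - i)" if i: "i \<in> {1..n-1}" for i
  proof -
    have "n - i \<in> {1..n-1}" "n - (n - i) = i" using i by auto
    moreover have "\<theta> (basis_vec i) (basis_vec (n - i)) = \<theta> (basis_vec (n - i)) (basis_vec i)"
      using i by (intro th_sym basis_vec_mem) auto
    ultimately show ?thesis using i by (simp add: t cocycle_tuple_def)
  qed
  have "t (i + j) * C i j = t (j + k) * C j k"
    if ijk: "i \<ge> 1" "j \<ge> 1" "k \<ge> 1" "i + j + k = n" for i j k
  proof -
    have mem: "i \<in> {1..n-1}" "j \<in> {1..n-1}" "k \<in> {1..n-1}" "i + j \<in> {1..n-1}" "j + k \<in> {1..n-1}"
      using ijk by auto
    note mem' = mem[THEN basis_vec_mem]
    have hom1: "\<And>s a b. a \<in> ?A \<Longrightarrow> b \<in> ?A \<Longrightarrow> \<theta> (\<lambda>l. s * a l) b = (\<lambda>l. s * \<theta> a b l)"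
      and hom2: "\<And>s a b. a \<in> ?A \<Longrightarrow> b \<in> ?A \<Longrightarrow> \<theta> a (\<lambda>l. s * b l) = (\<lambda>l. s * \<theta> a b l)"
      and coc: "\<And>a b c. a \<in> ?A \<Longrightarrow> b \<in> ?A \<Longrightarrow> c \<in> ?A \<Longrightarrow>
           \<theta> (diag_mult (n - 1) C a b) c = \<theta> a (diag_mult (n - 1) C b c)"
      by (rule th[unfolded graded_cocycle_def Let_def, THEN conjunct2, THEN conjunct2, THEN conjunct2, THEN conjunct2, THEN conjunct1, rule_format]
          th[unfolded graded_cocycle_def Let_def, THEN conjunct2, THEN conjunct2, THEN conjunct2, THEN conjunct2, THEN conjunct2, THEN conjunct1, rule_format]
          th[unfolded graded_cocycle_def Let_def, THEN conjunct2, THEN conjunct2, THEN conjunct2, THEN conjunct2, THEN conjunct2, THEN conjunct2, THEN conjunct2, rule_format]; assumption)+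
    have "\<theta> (diag_mult (n - 1) C (basis_vec i) (basis_vec j)) (basis_vec k) n
        = \<theta> (basis_vec i) (diag_mult (n - 1) C (basis_vec j) (basis_vec k)) n"
      by (rule fun_cong, rule coc) (rule mem')+
    moreover have "diag_mult (n - 1) C (basis_vec i) (basis_vec j) = (\<lambda>l. C i j * basis_vec (i + j) l)"
      "diag_mult (n - 1) C (basis_vec j) (basis_vec k) = (\<lambda>l. C j k * basis_vec (j + k) l)"
      using ijk mem by (simp_all add: diag_mult_basis)
    ultimately have "C i j * \<theta> (basis_vec (i + j)) (basis_vec k) n
        = C j k * \<theta> (basis_vec i) (basis_vec (j + k)) n"
      by (simp add: hom1[OF mem'(4) mem'(3)] hom2[OF mem'(1) mem'(5)])
    moreover have "n - (i + j) = k" "n - i = j + k" using ijk by auto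
    ultimately have "C i j * t (i + j) = C j k * t i"
      using mem by (simp add: t cocycle_tuple_def)
    then show ?thesis
      using sym[OF mem(1)] \<open>n - i = j + k\<close> by (simp add: mult.commute)
  qed
  moreover have "t \<in> coord_space {1..n-1}"
    by (simp add: t cocycle_tuple_def coord_space_def)
  ultimately show "t \<in> ?R" using sym by blast
next
  fix t assume t: "t \<in> ?R"
  have tsupp: "\<And>i. i \<notin> {1..n-1} \<Longrightarrow> t i = 0"
    using t unfolding coord_space_def by blast
  have tsym: "\<And>i. i \<in> {1..n-1} \<Longrightarrow> t (n - i) = t i"
    using t[THEN CollectD, THEN conjunct2, THEN conjunct1] by simp
  have tcoc: "t (i + j) * C i j = t (j + k) * C j k"
    if "i \<ge> 1" "j \<ge> 1" "k \<ge> 1" "i + j + k = n" for i j k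
    using t that by blast
  define \<theta> :: "(nat \<Rightarrow> 'k) \<Rightarrow> (nat \<Rightarrow> 'k) \<Rightarrow> nat \<Rightarrow> 'k" where
    "\<theta> = (\<lambda>a b l. if l = n then \<Sum>i=1..n-1. t i * a i * b (n - i) else 0)"
  have sym: "\<theta> a b = \<theta> b a" for a b
  proof -
    have "(\<Sum>i=1..n-1. t i * a i * b (n - i)) = (\<Sum>i=1..n-1. t i * b i * a (n - i))"
      by (rule sum.reindex_bij_witness[where i = "\<lambda>i. n - i" and j = "\<lambda>i. n - i"])
         (auto simp: tsym)
    then show ?thesis by (simp add: \<theta>_def fun_eq_iff)
  qed
  have coc: "\<theta> (diag_mult (n - 1) C a b) c = \<theta> a (diag_mult (n - 1) C b c)" for a b c
  proof -
    have "(\<Sum>m=1..n-1. t m * diag_mult (n - 1) C a b m * c (n - m))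
        = (\<Sum>m=1..n-1. \<Sum>i=1..<m. t (i + (m - i)) * C i (m - i) * a i * b (m - i) * c (n - m))"
      by (intro sum.cong) (auto simp: diag_mult_def sum_distrib_left sum_distrib_right mult_ac intro!: sum.cong)
    also have "\<dots> = (\<Sum>(i,j,k)\<in>{(i,j,k). i \<ge> 1 \<and> j \<ge> 1 \<and> k \<ge> 1 \<and> i + j + k = n}.
                        t (i + j) * C i j * a i * b j * c k)"
      by (rule sum_triples_left)
    also have "\<dots> = (\<Sum>(i,j,k)\<in>{(i,j,k). i \<ge> 1 \<and> j \<ge> 1 \<and> k \<ge> 1 \<and> i + j + k = n}.
                        t (j + k) * C j k * a i * b j * c k)"
    proof (intro sum.cong refl)
      fix x assume "x \<in> {(i,j,k). i \<ge> 1 \<and> j \<ge> 1 \<and> k \<ge> 1 \<and> i + j + k = n}"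
      then obtain i j k where "x = (i, j, k)" "i \<ge> 1" "j \<ge> 1" "k \<ge> 1" "i + j + k = n"
        by blast
      then show "(case x of (i,j,k) \<Rightarrow> t (i + j) * C i j * a i * b j * c k)
          = (case x of (i,j,k) \<Rightarrow> t (j + k) * C j k * a i * b j * c k)"
        using tcoc[of i j k] by simp
    qed
    also have "\<dots> = (\<Sum>i=1..n-1. \<Sum>j=1..<n-i. t (j + (n - i - j)) * C j (n - i - j) * a i * b j * c (n - i - j))"
      by (rule sum_triples_right[symmetric])
    also have "\<dots> = (\<Sum>i=1..n-1. t i * a i * diag_mult (n - 1) C b c (n - i))"
    proof (intro sum.cong refl)
      fix i assume i: "i \<in> {1..n-1}"
      have "t (j + (n - i - j)) = t i" if "j \<in> {1..<n-i}" for j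
      proof -
        have "j + (n - i - j) = n - i" using that by auto
        then show ?thesis using tsym[OF i] by simp
      qed
      then show "(\<Sum>j=1..<n-i. t (j + (n - i - j)) * C j (n - i - j) * a i * b j * c (n - i - j))
          = t i * a i * diag_mult (n - 1) C b c (n - i)"
        using i by (auto simp: diag_mult_def sum_distrib_left mult_ac intro!: sum.cong)
    qed
    finally show ?thesis by (simp add: \<theta>_def fun_eq_iff)
  qed
  have deg: "\<theta> a b \<in> coord_space ({n} \<inter> {i + j})"
    if "a \<in> coord_space ({1..n-1} \<inter> {i})" "b \<in> coord_space ({1..n-1} \<inter> {j})" for a b i j
  proof -
    have "(\<Sum>x=1..n-1. t x * a x * b (n - x)) = 0" if "n \<noteq> i + j"
    proof (rule sum.neutral, rule ballI)
      fix x assume "x \<in> {1..n-1}"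
      then have "x \<noteq> i \<or> n - x \<noteq> j" using that by auto
      then show "t x * a x * b (n - x) = 0"
        using \<open>a \<in> _\<close> \<open>b \<in> _\<close> by (auto simp: coord_space_def)
    qed
    then show ?thesis by (auto simp: \<theta>_def coord_space_def)
  qed
  have "graded_cocycle n C \<theta>"
    unfolding graded_cocycle_def Let_def
  proof (intro conjI allI ballI)
    show "\<theta> a b \<in> coord_space {n}" for a b
      by (auto simp: \<theta>_def coord_space_def)
    show "\<theta> a b = \<theta> b a" for a b
      by (rule sym)
    show "\<theta> (diag_mult (n - 1) C a b) c = \<theta> a (diag_mult (n - 1) C b c)" for a b c
      by (rule coc)
    show "\<theta> a b \<in> coord_space ({n} \<inter> {i + j})"
      if "a \<in> coord_space ({1..n-1} \<inter> {i})" "b \<in> coord_space ({1..n-1} \<inter> {j})" for a b i j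
      using that by (rule deg)
  qed (simp_all add: \<theta>_def fun_eq_iff sum.distrib sum_distrib_left distrib_left distrib_right mult_ac)
  moreover have "cocycle_tuple n \<theta> = t"
  proof
    fix i
    have "(\<Sum>x=1..n-1. t x * basis_vec i x * basis_vec (n - i) (n - x)) = t i" if "i \<in> {1..n-1}"
    proof -
      have "(\<Sum>x=1..n-1. t x * basis_vec i x * basis_vec (n - i) (n - x))
          = (\<Sum>x=1..n-1. if x = i then t i else 0)"
        by (intro sum.cong) (auto simp: basis_vec_def)
      then show ?thesis using that by simp
    qed
    then show "cocycle_tuple n \<theta> i = t i"
      using tsupp by (auto simp: cocycle_tuple_def \<theta>_def)
  qed
  ultimately show "t \<in> cocycle_space n C"
    by (auto simp: cocycle_space_def)
qed


section \<open>The graph of a matrix\<close>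

definition gr_adj :: "nat \<Rightarrow> (nat \<Rightarrow> nat \<Rightarrow> 'k::field) \<Rightarrow> nat \<Rightarrow> nat \<Rightarrow> bool" where
  "gr_adj n C p q \<longleftrightarrow> p \<in> {1..n-1} \<and> q \<in> {1..n-1} \<and> p \<noteq> q \<and>
     (p + q = n \<or>
      (\<exists>i\<ge>1. \<exists>j\<ge>1. \<exists>k\<ge>1. i + j + k = n \<and> p = i + j \<and> q = j + k \<and> C i j * C j k \<noteq> 0))"

lemma gr_adj_sym:
  assumes "C \<in> diag_matrices (n - 1)" "gr_adj n C p q"
  shows "gr_adj n C q p"
proof -
  have C: "\<And>i j. C i j = C j i" using assms(1) by (simp add: diag_matrices_def)
  have "\<exists>i\<ge>1. \<exists>j\<ge>1. \<exists>k\<ge>1. i + j + k = n \<and> q = i + j \<and> p = j + k \<and> C i j * C j k \<noteq> 0"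
    if "i \<ge> 1" "j \<ge> 1" "k \<ge> 1" "i + j + k = n" "p = i + j" "q = j + k" "C i j * C j k \<noteq> 0" for i j k
    using that C[of i j] C[of j k]
    by (intro exI[of _ k] exI[of _ j] exI[of _ i] conjI) (auto simp: add_ac)
  then show ?thesis using assms(2) unfolding gr_adj_def by (elim conjE disjE exE) (auto simp: add.commute)
qed

definition gr_components :: "nat \<Rightarrow> (nat \<Rightarrow> nat \<Rightarrow> 'k::field) \<Rightarrow> nat set set" where
  "gr_components n C =
     {1..n-1} // {(p, q). p \<in> {1..n-1} \<and> q \<in> {1..n-1} \<and> (gr_adj n C)\<^sup>*\<^sup>* p q}"

definition contractible_component :: "nat \<Rightarrow> (nat \<Rightarrow> nat \<Rightarrow> 'k::field) \<Rightarrow> nat set \<Rightarrow> bool" where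
  "contractible_component n C K \<longleftrightarrow>
     (\<exists>i\<ge>1. \<exists>j\<ge>1. i + j \<in> K \<and> C i j \<noteq> 0 \<and> C j (n - i - j) = 0)"

definition num_generic_components :: "nat \<Rightarrow> (nat \<Rightarrow> nat \<Rightarrow> 'k::field) \<Rightarrow> nat" where
  "num_generic_components n C = card {K \<in> gr_components n C. \<not> contractible_component n C K}"

end

theory Submission
  imports Defs "HOL-Library.FuncSet"
begin

text \<open>
  The cocycle space \<open>W\<close> is cut out by linear equations. It is irreducible because two polynomial
  functions that do not vanish on \<open>W\<close> restrict to nonzero univariate polynomials on the line through
  suitable points of \<open>W\<close>, and over an infinite field their product cannot vanish on that line
  (\<open>affine_subvariety_of_lines\<close>).

  Along an edge of the graph the two coordinates of a cocycle are proportional, with a factor that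
  depends only on \<open>C\<close>: an edge \<open>p + q = n\<close> gives \<open>\<theta>\<^sub>p = \<theta>\<^sub>q\<close>, and an edge from a triple
  \<open>i + j + k = n\<close> gives \<open>\<theta>\<^bsub>i+j\<^esub> c\<^sub>i\<^sub>j = \<theta>\<^bsub>j+k\<^esub> c\<^sub>j\<^sub>k\<close> with both coefficients nonzero. So a cocycle is
  determined on a component by its value at one vertex. On a contractible component one of these
  equations reads \<open>\<theta>\<^bsub>i+j\<^esub> c\<^sub>i\<^sub>j = 0\<close> with \<open>c\<^sub>i\<^sub>j \<noteq> 0\<close>, and the cocycle vanishes there. Hence all
  coordinates on \<open>W\<close> are multiples of those at one representative of each generic component.

  It remains to bound the Krull dimension of a set \<open>X\<close> on which all coordinates are linear
  combinations of \<open>u\<close> of them (\<open>variety_dim_le_card_coordinates\<close>). Given a chain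
  \<open>Y\<^sub>0 \<subset> \<dots> \<subset> Y\<^sub>r\<close> of irreducible closed subsets of \<open>X\<close>, choose polynomial functions \<open>f\<^sub>i\<close> that vanish on
  \<open>Y\<^sub>i\<close> but not on \<open>Y\<^bsub>i+1\<^esub>\<close>. They are algebraically independent on \<open>Y\<^sub>r\<close>
  (\<open>chain_power_products_independent\<close>). But the \<open>(N + 1)\<^sup>r\<close> products of powers of the \<open>f\<^sub>i\<close> with
  exponents at most \<open>N\<close> are, on \<open>X\<close>, combinations of monomials in \<open>u\<close> coordinates with exponents
  \<open>O(N)\<close>, of which there are only \<open>O(N\<^sup>u)\<close>. So \<open>r > u\<close> would force a linear relation.
\<close>


section \<open>More unknowns than equations\<close>

text \<open>
  Gaussian elimination of one equation at a time: a row \<open>a0\<close> with a nonzero entry in column \<open>b\<close> is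
  used to clear that column.
\<close>

lemma nontrivial_solution_exists:
  fixes M :: "'a \<Rightarrow> 'b \<Rightarrow> 'k::field"
  assumes "finite B" "finite A" "card B < card A"
  shows "\<exists>c. (\<exists>a\<in>A. c a \<noteq> 0) \<and> (\<forall>b\<in>B. (\<Sum>a\<in>A. c a * M a b) = 0)"
  using assms
proof (induction B arbitrary: A M rule: finite_induct)
  case empty
  then obtain a where "a \<in> A" by (metis card_gt_0_iff card.empty ex_in_conv)
  then show ?case by (intro exI[of _ "\<lambda>_. 1"]) auto
next
  case (insert b B)
  show ?case
  proof (cases "\<forall>a\<in>A. M a b = 0")
    case True
    have "card B < card A" using insert by auto
    from insert.IH[OF insert.prems(1) this, of M] True show ?thesis by auto
  next
    case False
    then obtain a0 where a0: "a0 \<in> A" "M a0 b \<noteq> 0" by blast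
    define A' where "A' = A - {a0}"
    have fin: "finite A'" and card: "card B < card A'"
      using insert a0 by (auto simp: A'_def)
    from insert.IH[OF fin card, of "\<lambda>a x. M a x - M a b / M a0 b * M a0 x"]
    obtain c where c: "\<exists>a\<in>A'. c a \<noteq> 0"
      and eq: "\<forall>x\<in>B. (\<Sum>a\<in>A'. c a * (M a x - M a b / M a0 b * M a0 x)) = 0" by blast
    \<comment> \<open>The coefficient of the pivot row is forced by the equation that \<open>b\<close> imposes.\<close>
    define d where "d = c(a0 := - (\<Sum>a\<in>A'. c a * M a b) / M a0 b)"
    have split: "(\<Sum>a\<in>A. d a * M a x)
        = (\<Sum>a\<in>A'. c a * M a x) - (\<Sum>a\<in>A'. c a * M a b) / M a0 b * M a0 x" for x
    proof -
      have "(\<Sum>a\<in>A. d a * M a x) = d a0 * M a0 x + (\<Sum>a\<in>A'. d a * M a x)"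
        unfolding A'_def by (rule sum.remove[OF insert.prems(1) a0(1)])
      moreover have "(\<Sum>a\<in>A'. d a * M a x) = (\<Sum>a\<in>A'. c a * M a x)"
        by (intro sum.cong) (auto simp: d_def A'_def)
      ultimately show ?thesis by (simp add: d_def)
    qed
    have "(\<Sum>a\<in>A. d a * M a x) = 0" if "x \<in> insert b B" for x
    proof (cases "x = b")
      case True
      then show ?thesis using a0 by (simp add: split)
    next
      case False
      then have "(\<Sum>a\<in>A'. c a * (M a x - M a b / M a0 b * M a0 x)) = 0" using that eq by blast
      then show ?thesis
        by (simp add: split right_diff_distrib sum_subtractf sum_distrib_right sum_divide_distrib mult.assoc)
    qed
    moreover have "\<exists>a\<in>A. d a \<noteq> 0" using c by (auto simp: d_def A'_def)
    ultimately show ?thesis by blast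
  qed
qed


section \<open>Functions of bounded degree in a set of coordinates\<close>

text \<open>
  The exponent of each variable is bounded separately by \<open>D\<close>, instead of the total degree: the
  monomials then form the product set \<open>R \<rightarrow>\<^sub>E {..D}\<close>, whose cardinality \<open>(D + 1) ^ card R\<close> is immediate.
  Only the values on \<open>X\<close> count, so that relations among the coordinates on \<open>X\<close> may be used.
\<close>

definition degree_bounded_on ::
    "('v \<Rightarrow> 'k::field) set \<Rightarrow> 'v set \<Rightarrow> nat \<Rightarrow> (('v \<Rightarrow> 'k) \<Rightarrow> 'k) \<Rightarrow> bool" where
  "degree_bounded_on X R D g \<longleftrightarrow>
     (\<exists>c. \<forall>x\<in>X. g x = (\<Sum>b\<in>R \<rightarrow>\<^sub>E {..D}. c b * (\<Prod>r\<in>R. x r ^ b r)))"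

lemma degree_bounded_on_monomial:
  assumes "finite R" "\<forall>r\<in>R. b r \<le> D"
  shows "degree_bounded_on X R D (\<lambda>x. s * (\<Prod>r\<in>R. x r ^ b r))"
  unfolding degree_bounded_on_def
proof (intro exI ballI)
  fix x :: "'a \<Rightarrow> 'b"
  have mem: "restrict b R \<in> R \<rightarrow>\<^sub>E {..D}" using assms by auto
  have "(\<Sum>g\<in>R \<rightarrow>\<^sub>E {..D}. (if g = restrict b R then s else 0) * (\<Prod>r\<in>R. x r ^ g r))
      = (\<Sum>g\<in>R \<rightarrow>\<^sub>E {..D}. if g = restrict b R then s * (\<Prod>r\<in>R. x r ^ g r) else 0)"
    by (intro sum.cong) auto
  also have "\<dots> = s * (\<Prod>r\<in>R. x r ^ restrict b R r)"
    using mem assms(1) by (subst sum.delta) (auto intro!: finite_PiE)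
  also have "(\<Prod>r\<in>R. x r ^ restrict b R r) = (\<Prod>r\<in>R. x r ^ b r)"
    by (intro prod.cong) auto
  finally show "s * (\<Prod>r\<in>R. x r ^ b r)
      = (\<Sum>g\<in>R \<rightarrow>\<^sub>E {..D}. (if g = restrict b R then s else 0) * (\<Prod>r\<in>R. x r ^ g r))" ..
qed

lemma degree_bounded_on_add:
  assumes "degree_bounded_on X R D f" "degree_bounded_on X R D g"
  shows "degree_bounded_on X R D (\<lambda>x. f x + g x)"
proof -
  from assms obtain c d where
    "\<forall>x\<in>X. f x = (\<Sum>b\<in>R \<rightarrow>\<^sub>E {..D}. c b * (\<Prod>r\<in>R. x r ^ b r))"
    "\<forall>x\<in>X. g x = (\<Sum>b\<in>R \<rightarrow>\<^sub>E {..D}. d b * (\<Prod>r\<in>R. x r ^ b r))"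
    unfolding degree_bounded_on_def by blast
  then show ?thesis unfolding degree_bounded_on_def
    by (intro exI[of _ "\<lambda>b. c b + d b"]) (simp add: distrib_right sum.distrib)
qed

lemma degree_bounded_on_const:
  assumes "finite R"
  shows "degree_bounded_on X R D (\<lambda>x. s)"
  using degree_bounded_on_monomial[OF assms, of "\<lambda>_. 0" D X s] by simp

lemma degree_bounded_on_sum:
  assumes "finite R" "\<And>i. i \<in> I \<Longrightarrow> degree_bounded_on X R D (f i)"
  shows "degree_bounded_on X R D (\<lambda>x. \<Sum>i\<in>I. f i x)"
  using assms(2)
  by (induction I rule: infinite_finite_induct)
     (auto simp: degree_bounded_on_const[OF assms(1)] intro!: degree_bounded_on_add)

lemma degree_bounded_on_cong:
  assumes "\<And>x. x \<in> X \<Longrightarrow> f x = g x"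
  shows "degree_bounded_on X R D f \<longleftrightarrow> degree_bounded_on X R D g"
  using assms by (simp add: degree_bounded_on_def)

lemma degree_bounded_on_mult:
  assumes "finite R" "degree_bounded_on X R D f" "degree_bounded_on X R E g"
  shows "degree_bounded_on X R (D + E) (\<lambda>x. f x * g x)"
proof -
  from assms(2,3) obtain c d where
    f: "\<And>x. x \<in> X \<Longrightarrow> f x = (\<Sum>b\<in>R \<rightarrow>\<^sub>E {..D}. c b * (\<Prod>r\<in>R. x r ^ b r))" and
    g: "\<And>x. x \<in> X \<Longrightarrow> g x = (\<Sum>b\<in>R \<rightarrow>\<^sub>E {..E}. d b * (\<Prod>r\<in>R. x r ^ b r))"
    unfolding degree_bounded_on_def by blast
  have "degree_bounded_on X R (D + E) (\<lambda>x. \<Sum>b\<in>R \<rightarrow>\<^sub>E {..D}. \<Sum>b'\<in>R \<rightarrow>\<^sub>E {..E}.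
          (c b * d b') * (\<Prod>r\<in>R. x r ^ (b r + b' r)))"
    using assms(1)
    by (intro degree_bounded_on_sum degree_bounded_on_monomial) (auto intro!: add_mono)
  then show ?thesis
    by (rule degree_bounded_on_cong[THEN iffD1, rotated])
       (simp add: f g sum_product power_add prod.distrib mult_ac)
qed

lemma degree_bounded_on_mono:
  assumes "finite R" "degree_bounded_on X R D f" "D \<le> E"
  shows "degree_bounded_on X R E f"
  using degree_bounded_on_mult[OF assms(1,2), of "E - D" "\<lambda>_. 1"] assms
  by (simp add: degree_bounded_on_const)

lemma degree_bounded_on_power:
  assumes "finite R" "degree_bounded_on X R D f"
  shows "degree_bounded_on X R (k * D) (\<lambda>x. f x ^ k)"
proof (induction k)
  case (Suc k)
  then show ?case using degree_bounded_on_mult[OF assms Suc.IH] by simp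
qed (use degree_bounded_on_const[OF assms(1)] in simp)

lemma degree_bounded_on_power_product:
  assumes "finite R" "\<And>i. i < m \<Longrightarrow> degree_bounded_on X R D (f i)" "\<And>i. i < m \<Longrightarrow> a i \<le> N"
  shows "degree_bounded_on X R (m * (N * D)) (\<lambda>x. \<Prod>i<m. f i x ^ a i)"
  using assms(2,3)
proof (induction m)
  case (Suc m)
  have "degree_bounded_on X R (N * D) (\<lambda>x. f m x ^ a m)"
    using degree_bounded_on_power[OF assms(1) Suc.prems(1), of m "a m"] Suc.prems(2)[of m]
    by (auto elim!: degree_bounded_on_mono[OF assms(1)] intro!: mult_right_mono)
  from degree_bounded_on_mult[OF assms(1) Suc.IH this] Suc.prems
  show ?case by (simp add: algebra_simps)
qed (simp add: degree_bounded_on_const[OF assms(1)])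

lemma degree_bounded_on_coord:
  assumes "finite R" "r \<in> R"
  shows "degree_bounded_on X R 1 (\<lambda>x. s * x r)"
proof -
  have "(\<Prod>q\<in>R. x q ^ (if q = r then 1 else 0)) = x r" for x :: "'a \<Rightarrow> 'b"
  proof -
    have "(\<Prod>q\<in>R. x q ^ (if q = r then 1 else 0)) = (\<Prod>q\<in>R. if q = r then x q else 1)"
      by (intro prod.cong) auto
    then show ?thesis using assms by (simp add: prod.delta)
  qed
  then show ?thesis
    using degree_bounded_on_monomial[OF assms(1), of "\<lambda>q. if q = r then 1 else 0" 1 X s] by simp
qed

lemma poly_function_degree_bounded_on:
  assumes "finite R" "\<And>p. p \<in> {1..m} \<Longrightarrow> \<exists>c. \<forall>x\<in>X. x p = (\<Sum>r\<in>R. c r * x r)"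
    and "f \<in> poly_functions m"
  shows "\<exists>D. degree_bounded_on X R D f"
  using assms(3)
proof induction
  case (const c)
  show ?case using degree_bounded_on_const[OF assms(1)] by blast
next
  case (coord p)
  then obtain c where c: "\<forall>x\<in>X. x p = (\<Sum>r\<in>R. c r * x r)" using assms(2) by blast
  have "degree_bounded_on X R 1 (\<lambda>x. \<Sum>r\<in>R. c r * x r)"
    by (intro degree_bounded_on_sum degree_bounded_on_coord assms(1))
  then show ?case using c by (intro exI[of _ 1]) (simp cong: degree_bounded_on_cong)
next
  case (add f g)
  then obtain D E where DE: "degree_bounded_on X R D f" "degree_bounded_on X R E g" by blast
  have "degree_bounded_on X R (max D E) (\<lambda>x. f x + g x)"
    by (intro degree_bounded_on_add degree_bounded_on_mono[OF assms(1) DE(1)]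
        degree_bounded_on_mono[OF assms(1) DE(2)]) auto
  then show ?case by blast
next
  case (mult f g)
  then show ?case using degree_bounded_on_mult[OF assms(1)] by blast
qed


section \<open>Polynomial functions on irreducible closed sets\<close>

lemma poly_functions_power: "f \<in> poly_functions m \<Longrightarrow> (\<lambda>x. f x ^ k) \<in> poly_functions m"
  by (induction k) (auto intro: poly_functions.intros)

lemma poly_functions_sum:
  "(\<And>i. i \<in> I \<Longrightarrow> f i \<in> poly_functions m) \<Longrightarrow> (\<lambda>x. \<Sum>i\<in>I. f i x) \<in> poly_functions m"
  by (induction I rule: infinite_finite_induct) (auto intro: poly_functions.intros)

lemma poly_functions_prod:
  "(\<And>i. i \<in> I \<Longrightarrow> f i \<in> poly_functions m) \<Longrightarrow> (\<lambda>x. \<Prod>i\<in>I. f i x) \<in> poly_functions m"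
  by (induction I rule: infinite_finite_induct) (auto intro: poly_functions.intros)

lemma zariski_closed_vanishing_subset:
  assumes "zariski_closed m X" "f \<in> poly_functions m"
  shows "zariski_closed m {x \<in> X. f x = 0}"
proof -
  from assms(1) obtain F where "F \<subseteq> poly_functions m" "X = {x \<in> coord_space {1..m}. \<forall>g\<in>F. g x = 0}"
    unfolding zariski_closed_def by blast
  then show ?thesis unfolding zariski_closed_def using assms(2)
    by (intro exI[of _ "insert f F"]) auto
qed

lemma affine_subvariety_mult_eq_0:
  fixes X :: "(nat \<Rightarrow> 'k::field) set"
  assumes "affine_subvariety m X" "f \<in> poly_functions m" "g \<in> poly_functions m"
    and "\<And>x. x \<in> X \<Longrightarrow> f x * g x = 0"
  shows "(\<forall>x\<in>X. f x = 0) \<or> (\<forall>x\<in>X. g x = 0)"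
proof -
  have "zariski_closed m X" using assms(1) by (simp add: affine_subvariety_def)
  then have "zariski_closed m {x \<in> X. f x = 0}" "zariski_closed m {x \<in> X. g x = 0}"
    using assms(2,3) by (auto intro: zariski_closed_vanishing_subset)
  moreover have "X = {x \<in> X. f x = 0} \<union> {x \<in> X. g x = 0}"
    using assms(4) by auto
  ultimately have "X = {x \<in> X. f x = 0} \<or> X = {x \<in> X. g x = 0}"
    using assms(1) unfolding affine_subvariety_def by blast
  then show ?thesis by blast
qed

text \<open>
  Used both to pick the functions along a chain of closed sets and to refute a decomposition of a
  linear subspace.
\<close>

lemma zariski_closed_separating_function:
  assumes "zariski_closed m Y" "zariski_closed m Z" "\<not> Z \<subseteq> Y"
  obtains f where "f \<in> poly_functions m" "\<forall>y\<in>Y. f y = 0" "\<exists>z\<in>Z. f z \<noteq> 0"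
proof -
  from assms(1) obtain F where F: "F \<subseteq> poly_functions m" 
    "Y = {x \<in> coord_space {1..m}. \<forall>g\<in>F. g x = 0}"
    unfolding zariski_closed_def by blast
  moreover have "Z \<subseteq> coord_space {1..m}" using assms(2) by (auto simp: zariski_closed_def)
  ultimately obtain z f where "z \<in> Z" "f \<in> F" "f z \<noteq> 0" using assms(3) by blast
  then show ?thesis using F by (intro that[of f]) auto
qed

text \<open>
  Induction on the length of the chain. In a relation that holds on \<open>Y (Suc r)\<close>, factor out the
  lowest power of \<open>f r\<close> that occurs. As \<open>f r\<close> does not vanish on the irreducible set \<open>Y (Suc r)\<close>, the
  cofactor does vanish there. On \<open>Y r\<close>, where \<open>f r\<close> is zero, only the terms with the lowest power
  survive in the cofactor, and they form a shorter relation among \<open>f 0, \<dots>, f (r - 1)\<close>.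

  The relation is given by a finite set \<open>A\<close> of exponents with nonzero coefficients. The exponents may
  differ outside \<open>{..<r}\<close>, which keeps the hypotheses stable under forgetting the last exponent;
  injectivity of the restriction says that distinct members of \<open>A\<close> are distinct exponents.
\<close>

lemma chain_power_products_independent:
  fixes Y :: "nat \<Rightarrow> (nat \<Rightarrow> 'k::field) set" and c :: "(nat \<Rightarrow> nat) \<Rightarrow> 'k"
  assumes "\<And>i. i \<le> r \<Longrightarrow> affine_subvariety m (Y i)"
    and "\<And>i. i < r \<Longrightarrow> Y i \<subseteq> Y (Suc i)"
    and "\<And>i. i < r \<Longrightarrow> f i \<in> poly_functions m"
    and "\<And>i y. i < r \<Longrightarrow> y \<in> Y i \<Longrightarrow> f i y = 0"
    and "\<And>i. i < r \<Longrightarrow> \<exists>y\<in>Y (Suc i). f i y \<noteq> 0"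
    and "finite A" "A \<noteq> {}" "\<And>a. a \<in> A \<Longrightarrow> c a \<noteq> 0"
    and "inj_on (\<lambda>a. restrict a {..<r}) A"
  shows "\<exists>y\<in>Y r. (\<Sum>a\<in>A. c a * (\<Prod>i<r. f i y ^ a i)) \<noteq> 0"
  using assms
proof (induction r arbitrary: A)
  case 0
  obtain a where a: "a \<in> A" using 0 by blast
  with 0 have "A = {a}" by (auto simp: inj_on_def)
  moreover obtain y where "y \<in> Y 0" using 0(1)[of 0] by (auto simp: affine_subvariety_def)
  ultimately show ?case using 0 by auto
next
  case (Suc r)
  define l where "l = Min ((\<lambda>a. a r) ` A)"
  have l_le: "l \<le> a r" if "a \<in> A" for a using that Suc.prems(6) by (simp add: l_def)
  have "l \<in> (\<lambda>a. a r) ` A" unfolding l_def using Suc.prems(6,7) by (intro Min_in) auto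
  define A' where "A' = {a \<in> A. a r = l}"
  have A': "finite A'" "A' \<noteq> {}" "A' \<subseteq> A" using \<open>l \<in> _\<close> Suc.prems(6) by (auto simp: A'_def)
  define P where "P = (\<lambda>a y. \<Prod>i<r. f i y ^ a i)"
  \<comment> \<open>The cofactor of \<open>f r ^ l\<close>; on \<open>Y r\<close> its second summand vanishes.\<close>
  define G where "G = (\<lambda>y. (\<Sum>a\<in>A'. c a * P a y) + f r y * (\<Sum>a\<in>A - A'. c a * P a y * f r y ^ (a r - l - 1)))"
  have P: "P a \<in> poly_functions m" for a
    unfolding P_def using Suc.prems(3) by (intro poly_functions_prod poly_functions_power) auto
  have fr: "f r \<in> poly_functions m" using Suc.prems(3) by simp
  have G: "G \<in> poly_functions m"
    unfolding G_def
    by (intro poly_functions.add poly_functions.mult poly_functions_sum poly_functions.const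
        poly_functions_power P fr)
  have factor: "(\<Sum>a\<in>A. c a * (\<Prod>i<Suc r. f i y ^ a i)) = f r y ^ l * G y" for y
  proof -
    have "(\<Sum>a\<in>A. c a * (\<Prod>i<Suc r. f i y ^ a i)) = (\<Sum>a\<in>A. c a * P a y * f r y ^ a r)"
      by (simp add: P_def mult.assoc)
    also have "\<dots> = (\<Sum>a\<in>A - A'. c a * P a y * f r y ^ a r) + (\<Sum>a\<in>A'. c a * P a y * f r y ^ a r)"
      by (rule sum.subset_diff[OF A'(3) Suc.prems(6)])
    also have "(\<Sum>a\<in>A'. c a * P a y * f r y ^ a r) = f r y ^ l * (\<Sum>a\<in>A'. c a * P a y)"
      by (simp add: A'_def sum_distrib_left mult_ac)
    also have "(\<Sum>a\<in>A - A'. c a * P a y * f r y ^ a r)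
        = f r y ^ l * (f r y * (\<Sum>a\<in>A - A'. c a * P a y * f r y ^ (a r - l - 1)))"
      unfolding sum_distrib_left
    proof (intro sum.cong refl)
      fix a assume "a \<in> A - A'"
      then have "a r > l" using l_le[of a] by (auto simp: A'_def)
      then have "f r y ^ a r = f r y ^ l * (f r y * f r y ^ (a r - l - 1))"
        by (simp flip: power_Suc power_add)
      then show "c a * P a y * f r y ^ a r
          = f r y ^ l * (f r y * (c a * P a y * f r y ^ (a r - l - 1)))" by simp
    qed
    finally show ?thesis by (simp add: G_def algebra_simps)
  qed
  show ?case
  proof (rule ccontr)
    assume "\<not> ?case"
    then have "f r y * G y = 0" if "y \<in> Y (Suc r)" for y
      using that factor by auto
    then have "\<forall>y\<in>Y (Suc r). G y = 0"
      using affine_subvariety_mult_eq_0[OF Suc.prems(1)[of "Suc r"] fr G] Suc.prems(5)[of r] by auto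
    then have zero: "(\<Sum>a\<in>A'. c a * P a y) = 0" if "y \<in> Y r" for y
    proof -
      have "y \<in> Y (Suc r)" "f r y = 0" using that Suc.prems(2)[of r] Suc.prems(4)[of r y] by auto
      then have "G y = 0" using \<open>\<forall>y\<in>Y (Suc r). G y = 0\<close> by blast
      then show ?thesis by (simp add: G_def \<open>f r y = 0\<close>)
    qed
    have inj: "inj_on (\<lambda>a. restrict a {..<r}) A'"
    proof (rule inj_onI)
      fix a b assume ab: "a \<in> A'" "b \<in> A'" "restrict a {..<r} = restrict b {..<r}"
      then have "a i = b i" if "i < r" for i using that by (metis lessThan_iff restrict_apply')
      moreover have "a r = b r" using ab by (simp add: A'_def)
      ultimately have "restrict a {..<Suc r} = restrict b {..<Suc r}"
        by (auto simp: restrict_def fun_eq_iff less_Suc_eq)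
      then show "a = b" using inj_onD[OF Suc.prems(9)] ab(1,2) A'(3) by blast
    qed
    have "\<exists>y\<in>Y r. (\<Sum>a\<in>A'. c a * (\<Prod>i<r. f i y ^ a i)) \<noteq> 0"
    proof (rule Suc.IH[OF _ _ _ _ _ A'(1,2) _ inj])
      show "c a \<noteq> 0" if "a \<in> A'" for a using that A'(3) Suc.prems(8) by blast
    qed (use Suc.prems(1-5) in auto)
    then show False using zero by (auto simp: P_def)
  qed
qed

text \<open>
  \<open>N\<close> is chosen such that \<open>(r * N * D + 1) ^ card R < (N + 1) ^ r\<close> as soon as \<open>card R < r\<close>: the left
  side is at most \<open>(r * D + 1) ^ card R * (N + 1) ^ card R\<close>, so \<open>N = (r * D + 1) ^ card R\<close> suffices.
\<close>

lemma variety_dim_le_card_coordinates: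
  fixes X :: "(nat \<Rightarrow> 'k::field) set"
  assumes "finite R" "\<And>p. p \<in> {1..m} \<Longrightarrow> \<exists>c. \<forall>x\<in>X. x p = (\<Sum>r\<in>R. c r * x r)"
  shows "variety_dim m X \<le> enat (card R)"
  unfolding variety_dim_def
proof (rule Sup_least, clarify)
  fix r Y
  assume Y: "\<forall>i\<le>r. affine_subvariety m (Y i) \<and> Y i \<subseteq> X" and chain: "\<forall>i<r. Y i \<subset> Y (Suc i)"
  have "\<exists>f. f \<in> poly_functions m \<and> (\<forall>y\<in>Y i. f y = 0) \<and> (\<exists>z\<in>Y (Suc i). f z \<noteq> 0)" if "i < r" for i
  proof -
    have "zariski_closed m (Y i)" "zariski_closed m (Y (Suc i))" "\<not> Y (Suc i) \<subseteq> Y i"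
      using that Y chain by (auto simp: affine_subvariety_def)
    then show ?thesis using zariski_closed_separating_function by metis
  qed
  then obtain f where f: "f i \<in> poly_functions m" "\<forall>y\<in>Y i. f i y = 0" "\<exists>z\<in>Y (Suc i). f i z \<noteq> 0"
    if "i < r" for i by metis
  have "\<exists>D. degree_bounded_on X R D (f i)" if "i < r" for i
    using poly_function_degree_bounded_on[OF assms f(1)[OF that]] .
  then obtain d where d: "degree_bounded_on X R (d i) (f i)" if "i < r" for i by metis
  define D where "D = (\<Sum>i<r. d i)"
  have D: "degree_bounded_on X R D (f i)" if "i < r" for i
    using that d by (intro degree_bounded_on_mono[OF assms(1) d]) (auto simp: D_def intro: member_le_sum)
  show "enat r \<le> enat (card R)"
  proof (rule ccontr)
    assume "\<not> enat r \<le> enat (card R)"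
    then have less: "Suc (card R) \<le> r" by simp
    define N where "N = (r * D + 1) ^ card R"
    define E where "E = r * (N * D)"
    define A where "A = {..<r} \<rightarrow>\<^sub>E {..N}"
    define B where "B = R \<rightarrow>\<^sub>E {..E}"
    have fin: "finite A" "finite B" using assms(1) by (auto simp: A_def B_def intro!: finite_PiE)
    have "card B = (E + 1) ^ card R" using assms(1) by (simp add: B_def card_PiE)
    also have "\<dots> \<le> ((r * D + 1) * (N + 1)) ^ card R"
      by (intro power_mono) (auto simp: E_def algebra_simps)
    also have "\<dots> = N * (N + 1) ^ card R" unfolding power_mult_distrib N_def[symmetric] ..
    also have "\<dots> < (N + 1) ^ Suc (card R)" by simp
    also have "\<dots> \<le> (N + 1) ^ r" using less by (intro power_increasing) auto
    also have "\<dots> = card A" by (simp add: A_def card_PiE)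
    finally have card: "card B < card A" .
    have "degree_bounded_on X R E (\<lambda>x. \<Prod>i<r. f i x ^ a i)" if "a \<in> A" for a
      unfolding E_def using that
      by (intro degree_bounded_on_power_product assms(1) D) (auto simp: A_def PiE_def Pi_def)
    then have "\<exists>M. \<forall>x\<in>X. (\<Prod>i<r. f i x ^ a i) = (\<Sum>b\<in>B. M b * (\<Prod>r\<in>R. x r ^ b r))" if "a \<in> A" for a
      using that unfolding degree_bounded_on_def B_def by blast
    then obtain M where M: "(\<Prod>i<r. f i x ^ a i) = (\<Sum>b\<in>B. M a b * (\<Prod>r\<in>R. x r ^ b r))"
      if "a \<in> A" "x \<in> X" for a x by metis
    obtain c where c: "\<exists>a\<in>A. c a \<noteq> 0" "\<forall>b\<in>B. (\<Sum>a\<in>A. c a * M a b) = 0"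
      using nontrivial_solution_exists[OF fin(2,1) card] by blast
    define S where "S = {a \<in> A. c a \<noteq> 0}"
    have "(\<Sum>a\<in>S. c a * (\<Prod>i<r. f i x ^ a i)) = 0" if "x \<in> X" for x
    proof -
      have "(\<Sum>a\<in>S. c a * (\<Prod>i<r. f i x ^ a i)) = (\<Sum>a\<in>A. c a * (\<Prod>i<r. f i x ^ a i))"
        using fin by (intro sum.mono_neutral_left) (auto simp: S_def)
      also have "\<dots> = (\<Sum>a\<in>A. \<Sum>b\<in>B. (c a * M a b) * (\<Prod>r\<in>R. x r ^ b r))"
        using M that by (simp add: sum_distrib_left mult.assoc)
      also have "\<dots> = (\<Sum>b\<in>B. (\<Sum>a\<in>A. c a * M a b) * (\<Prod>r\<in>R. x r ^ b r))"
        by (subst sum.swap) (simp add: sum_distrib_right)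
      finally show ?thesis using c(2) by simp
    qed
    moreover have "\<exists>y\<in>Y r. (\<Sum>a\<in>S. c a * (\<Prod>i<r. f i y ^ a i)) \<noteq> 0"
    proof (rule chain_power_products_independent)
      show "inj_on (\<lambda>a. restrict a {..<r}) S"
      proof (rule inj_on_cong[THEN iffD2, OF _ inj_on_id2])
        show "restrict a {..<r} = a" if "a \<in> S" for a
          using that unfolding S_def A_def by (blast intro: PiE_restrict)
      qed
      show "f i y = 0" if "i < r" "y \<in> Y i" for i y using f(2) that by blast
      show "\<exists>y\<in>Y (Suc i). f i y \<noteq> 0" if "i < r" for i using f(3) that by blast
      show "f i \<in> poly_functions m" if "i < r" for i using f(1) that by blast
      show "affine_subvariety m (Y i)" if "i \<le> r" for i using Y that by blast
      show "Y i \<subseteq> Y (Suc i)" if "i < r" for i using chain that by blast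
      show "finite S" "S \<noteq> {}" using fin c(1) by (auto simp: S_def)
      show "c a \<noteq> 0" if "a \<in> S" for a using that by (simp add: S_def)
    qed
    ultimately show False using Y by blast
  qed
qed


section \<open>Irreducibility of linear subspaces\<close>

text \<open>
  Over a finite field, the polynomial \<open>1 + \<Prod>a. (x - a)\<close> takes the value \<open>1\<close> everywhere and so has no root.
\<close>

lemma alg_closed_infinite: "infinite (UNIV :: 'k::alg_closed_field set)"
proof
  assume fin: "finite (UNIV :: 'k set)"
  define q :: "'k poly" where "q = (\<Prod>a\<in>UNIV. [:- a, 1:])"
  have "degree q = card (UNIV :: 'k set)" by (simp add: q_def degree_prod_sum_eq)
  then have "degree (1 + q) > 0" using fin by (simp add: degree_add_eq_right finite_UNIV_card_ge_0)
  then obtain x where "poly (1 + q) x = 0" using alg_closed_imp_poly_has_root by blast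
  moreover have "poly q x = 0" using fin by (auto simp: q_def poly_prod)
  ultimately show False by simp
qed

lemma poly_function_on_line:
  assumes "f \<in> poly_functions m"
  shows "\<exists>q. \<forall>s. poly q s = f (\<lambda>i. x i + s * y i)"
  using assms
proof induction
  case (const c)
  show ?case by (intro exI[of _ "[:c:]"]) simp
next
  case (coord i)
  show ?case by (intro exI[of _ "[:x i, y i:]"]) simp
next
  case (add f g)
  then show ?case by (metis poly_add)
next
  case (mult f g)
  then show ?case by (metis poly_mult)
qed

text \<open>
  If \<open>f\<close> does not vanish at \<open>a\<close> and \<open>g\<close> not at \<open>b\<close>, then on the line from \<open>a\<close> to \<open>b\<close> both are nonzero
  univariate polynomials. Their product has finitely many roots, so the line cannot be covered by the
  zero sets of \<open>f\<close> and \<open>g\<close>.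
\<close>

lemma affine_subvariety_of_lines:
  fixes X :: "(nat \<Rightarrow> 'k::field) set"
  assumes "infinite (UNIV :: 'k set)" "zariski_closed m X" "X \<noteq> {}"
    and lines: "\<And>x y s. x \<in> X \<Longrightarrow> y \<in> X \<Longrightarrow> (\<lambda>i. x i + s * (y i - x i)) \<in> X"
  shows "affine_subvariety m X"
  unfolding affine_subvariety_def
proof (intro conjI assms(2,3) allI impI)
  fix Y Z assume YZ: "zariski_closed m Y" "zariski_closed m Z" "X = Y \<union> Z"
  show "X = Y \<or> X = Z"
  proof (rule ccontr)
    assume neg: "\<not> (X = Y \<or> X = Z)"
    obtain f a where f: "f \<in> poly_functions m" "\<forall>y\<in>Y. f y = 0" "a \<in> X" "f a \<noteq> 0"
      using zariski_closed_separating_function[OF YZ(1) assms(2)] neg YZ(3) by blast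
    obtain g b where g: "g \<in> poly_functions m" "\<forall>y\<in>Z. g y = 0" "b \<in> X" "g b \<noteq> 0"
      using zariski_closed_separating_function[OF YZ(2) assms(2)] neg YZ(3) by blast
    obtain p where p: "\<And>s. poly p s = f (\<lambda>i. a i + s * (b i - a i))"
      using poly_function_on_line[OF f(1), of a "\<lambda>i. b i - a i"] by blast
    obtain q where q: "\<And>s. poly q s = g (\<lambda>i. a i + s * (b i - a i))"
      using poly_function_on_line[OF g(1), of a "\<lambda>i. b i - a i"] by blast
    have "p \<noteq> 0" using p[of 0] f(4) by auto
    moreover have "q \<noteq> 0" using q[of 1] g(4) by auto
    moreover have "poly (p * q) s = 0" for s
      using lines[OF f(3) g(3), of s] f(2) g(2) YZ(3) by (auto simp: p q)
    ultimately show False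
      using poly_roots_finite[of "p * q"] assms(1) by simp
  qed
qed


section \<open>The cocycle space\<close>

lemma zariski_closed_cocycle_space:
  fixes C :: "nat \<Rightarrow> nat \<Rightarrow> 'k::field"
  shows "zariski_closed (n - 1) (cocycle_space n C)"
proof -
  have diff: "(\<lambda>t. t p * a - t q * b) \<in> poly_functions (n - 1)" if "p \<in> {1..n-1}" "q \<in> {1..n-1}"
    for p q and a b :: 'k
  proof -
    have "(\<lambda>t. t p * a + t q * (- b)) \<in> poly_functions (n - 1)"
      by (intro poly_functions.intros that)
    then show ?thesis by simp
  qed
  define F1 :: "((nat \<Rightarrow> 'k) \<Rightarrow> 'k) set"
    where "F1 = (\<lambda>i t. t i - t (n - i)) ` {1..n-1}"
  define T where "T = {(i, j, k). i \<ge> 1 \<and> j \<ge> 1 \<and> k \<ge> 1 \<and> i + j + k = n}"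
  define F2 :: "((nat \<Rightarrow> 'k) \<Rightarrow> 'k) set"
    where "F2 = (\<lambda>(i, j, k) t. t (i + j) * C i j - t (j + k) * C j k) ` T"
  have "F1 \<subseteq> poly_functions (n - 1)"
  proof
    fix f assume "f \<in> F1"
    then obtain i where "f = (\<lambda>t. t i - t (n - i))" "i \<in> {1..n-1}" unfolding F1_def by blast
    moreover from this have "n - i \<in> {1..n-1}" by auto
    ultimately show "f \<in> poly_functions (n - 1)" using diff[of i "n - i" 1 1] by simp
  qed
  moreover have "F2 \<subseteq> poly_functions (n - 1)"
  proof
    fix f assume "f \<in> F2"
    then obtain i j k where "f = (\<lambda>t. t (i + j) * C i j - t (j + k) * C j k)"
      "i \<ge> 1" "j \<ge> 1" "k \<ge> 1" "i + j + k = n" unfolding F2_def T_def by auto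
    then show "f \<in> poly_functions (n - 1)" using diff[of "i + j" "j + k" "C i j" "C j k"] by simp
  qed
  ultimately have "F1 \<union> F2 \<subseteq> poly_functions (n - 1)" by blast
  moreover have "cocycle_space n C = {t \<in> coord_space {1..n-1}. \<forall>f\<in>F1 \<union> F2. f t = 0}"
  proof (rule set_eqI)
    fix t :: "nat \<Rightarrow> 'k"
    have "(\<forall>f\<in>F1. f t = 0) \<longleftrightarrow> (\<forall>i\<in>{1..n-1}. t i = t (n - i))"
      unfolding F1_def by simp
    moreover have "(\<forall>f\<in>F2. f t = 0) \<longleftrightarrow> (\<forall>i\<ge>1. \<forall>j\<ge>1. \<forall>k\<ge>1. i + j + k = n \<longrightarrow>
        t (i + j) * C i j - t (j + k) * C j k = 0)"
      by (simp add: F2_def T_def) blast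
    ultimately show "t \<in> cocycle_space n C \<longleftrightarrow> t \<in> {t \<in> coord_space {1..n-1}. \<forall>f\<in>F1 \<union> F2. f t = 0}"
      unfolding cocycle_space_eq mem_Collect_eq ball_Un right_minus_eq by blast
  qed
  ultimately show ?thesis unfolding zariski_closed_def by blast
qed

lemma affine_subvariety_cocycle_space:
  fixes C :: "nat \<Rightarrow> nat \<Rightarrow> 'k::field"
  assumes "infinite (UNIV :: 'k set)"
  shows "affine_subvariety (n - 1) (cocycle_space n C)"
proof (rule affine_subvariety_of_lines[OF assms zariski_closed_cocycle_space])
  have "(\<lambda>_. 0) \<in> cocycle_space n C" by (simp add: cocycle_space_eq coord_space_def)
  then show "cocycle_space n C \<noteq> {}" by blast
next
  fix x y :: "nat \<Rightarrow> 'k" and s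
  assume x: "x \<in> cocycle_space n C" and y: "y \<in> cocycle_space n C"
  let ?z = "\<lambda>i. x i + s * (y i - x i)"
  have "?z \<in> coord_space {1..n-1}"
    using x y unfolding cocycle_space_eq coord_space_def by simp
  moreover have "?z i = ?z (n - i)" if "i \<in> {1..n-1}" for i
  proof -
    have "x i = x (n - i)" "y i = y (n - i)" using x y that unfolding cocycle_space_eq by blast+
    then show ?thesis by simp
  qed
  moreover have "?z (i + j) * C i j = ?z (j + k) * C j k"
    if "i \<ge> 1" "j \<ge> 1" "k \<ge> 1" "i + j + k = n" for i j k
  proof -
    have "x (i + j) * C i j = x (j + k) * C j k" "y (i + j) * C i j = y (j + k) * C j k"
      using x y that unfolding cocycle_space_eq by blast+
    then show ?thesis by algebra
  qed
  ultimately show "?z \<in> cocycle_space n C" unfolding cocycle_space_eq by blast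
qed

text \<open>
  The factor \<open>s\<close> is uniform in the cocycle \<open>t\<close>; this uniformity is what makes one coordinate per
  component enough to bound the dimension.
\<close>

lemma cocycle_proportional_adjacent:
  assumes "gr_adj n C p q"
  shows "\<exists>s. \<forall>t\<in>cocycle_space n C. t p = s * t q"
proof -
  from assms have p: "p \<in> {1..n-1}" by (simp add: gr_adj_def)
  from assms consider "p + q = n"
    | i j k where "i \<ge> 1" "j \<ge> 1" "k \<ge> 1" "i + j + k = n" "p = i + j" "q = j + k" "C i j \<noteq> 0" "C j k \<noteq> 0"
    unfolding gr_adj_def by auto
  then show ?thesis
  proof cases
    case 1
    then have "q = n - p" by simp
    then show ?thesis using p unfolding cocycle_space_eq by (intro exI[of _ 1] ballI) simp
  next
    case 2
    have "t p = C j k / C i j * t q" if "t \<in> cocycle_space n C" for t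
    proof -
      have "t p * C i j = t q * C j k" using that 2 unfolding cocycle_space_eq by blast
      then show ?thesis using 2 by (simp add: field_simps)
    qed
    then show ?thesis by blast
  qed
qed

lemma cocycle_proportional_connected:
  assumes "(gr_adj n C)\<^sup>*\<^sup>* p q"
  shows "\<exists>s. \<forall>t\<in>cocycle_space n C. t p = s * t q"
  using assms
proof induction
  case base
  show ?case by (intro exI[of _ 1]) simp
next
  case (step q r)
  from step.IH obtain s where s: "\<forall>t\<in>cocycle_space n C. t p = s * t q" by blast
  from cocycle_proportional_adjacent[OF step.hyps(2)]
  obtain s' where "\<forall>t\<in>cocycle_space n C. t q = s' * t r" by blast
  with s have "\<forall>t\<in>cocycle_space n C. t p = s * s' * t r" by (metis mult.assoc)
  then show ?case ..
qed

lemma gr_component_connected: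
  assumes "C \<in> diag_matrices (n - 1)" "K \<in> gr_components n C" "p \<in> K" "q \<in> K"
  shows "(gr_adj n C)\<^sup>*\<^sup>* p q"
proof -
  from assms(2) obtain x where K: "K = {p. p \<in> {1..n-1} \<and> (gr_adj n C)\<^sup>*\<^sup>* x p}"
    by (auto simp: gr_components_def quotient_def)
  have "symp (gr_adj n C)" using gr_adj_sym[OF assms(1)] by (auto intro: sympI)
  then have "(gr_adj n C)\<^sup>*\<^sup>* p x" using assms(3) K by (auto dest: sympD[OF symp_rtranclp])
  also have "(gr_adj n C)\<^sup>*\<^sup>* x q" using assms(4) K by simp
  finally show ?thesis .
qed

text \<open>
  The cocycle equation of the triple \<open>(i, j, n - i - j)\<close> that witnesses contractibility forces
  \<open>t (i + j) = 0\<close>, and proportionality spreads this zero over the component.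
\<close>

lemma cocycle_zero_on_contractible:
  assumes "C \<in> diag_matrices (n - 1)" "K \<in> gr_components n C" "contractible_component n C K"
    and "t \<in> cocycle_space n C" "p \<in> K"
  shows "t p = 0"
proof -
  from assms(3) obtain i j where ij: "i \<ge> 1" "j \<ge> 1" "i + j \<in> K" "C i j \<noteq> 0" "C j (n - i - j) = 0"
    unfolding contractible_component_def by blast
  have "i + j \<in> {1..n-1}" using ij(3) assms(2) by (auto simp: gr_components_def quotient_def)
  then have k: "n - i - j \<ge> 1" "i + j + (n - i - j) = n" by auto
  have "t (i + j) * C i j = t (j + (n - i - j)) * C j (n - i - j)"
    using assms(4) ij(1,2) k unfolding cocycle_space_eq by blast
  then have "t (i + j) = 0" using ij by simp
  moreover obtain s where "t p = s * t (i + j)"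
    using cocycle_proportional_connected[OF gr_component_connected[OF assms(1,2,5) ij(3)]] assms(4)
    by blast
  ultimately show ?thesis by simp
qed

lemma variety_dim_cocycle_space_le:
  assumes C: "C \<in> diag_matrices (n - 1)"
  shows "variety_dim (n - 1) (cocycle_space n C) \<le> enat (num_generic_components n C)"
proof -
  define \<G> where "\<G> = {K \<in> gr_components n C. \<not> contractible_component n C K}"
  define rep :: "nat set \<Rightarrow> nat" where "rep K = (SOME x. x \<in> K)" for K
  have "finite (gr_components n C)"
    unfolding gr_components_def by (rule finite_quotient) auto
  then have fin: "finite \<G>" by (simp add: \<G>_def)
  have "variety_dim (n - 1) (cocycle_space n C) \<le> enat (card (rep ` \<G>))"
  proof (rule variety_dim_le_card_coordinates)
    show "finite (rep ` \<G>)" using fin by simp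
  next
    fix p assume p: "p \<in> {1..n-1}"
    define K where "K = {q. q \<in> {1..n-1} \<and> (gr_adj n C)\<^sup>*\<^sup>* p q}"
    have K: "K \<in> gr_components n C" "p \<in> K"
      using p by (auto simp: gr_components_def quotient_def K_def)
    show "\<exists>c. \<forall>t\<in>cocycle_space n C. t p = (\<Sum>r\<in>rep ` \<G>. c r * t r)"
    proof (cases "contractible_component n C K")
      case True
      then show ?thesis
        using cocycle_zero_on_contractible[OF C K(1) True _ K(2)]
        by (intro exI[of _ "\<lambda>_. 0"] ballI) simp
    next
      case False
      then have mem: "rep K \<in> rep ` \<G>" using K by (simp add: \<G>_def)
      have "rep K \<in> K" unfolding rep_def using K(2) by (rule someI)
      then obtain s where s: "\<forall>t\<in>cocycle_space n C. t p = s * t (rep K)"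
        using cocycle_proportional_connected[OF gr_component_connected[OF C K]] by blast
      have "(\<Sum>r\<in>rep ` \<G>. (if r = rep K then s else 0) * t r) = s * t (rep K)" for t :: "nat \<Rightarrow> 'a"
      proof -
        have "(\<Sum>r\<in>rep ` \<G>. (if r = rep K then s else 0) * t r)
            = (\<Sum>r\<in>rep ` \<G>. if r = rep K then s * t r else 0)" by (intro sum.cong) auto
        then show ?thesis using fin mem by simp
      qed
      with s show ?thesis by (intro exI[of _ "\<lambda>r. if r = rep K then s else 0"] ballI) metis
    qed
  qed
  also have "card (rep ` \<G>) \<le> num_generic_components n C"
    using card_image_le[OF fin] by (simp add: num_generic_components_def \<G>_def)
  finally show ?thesis by simp
qed

theorem theorem3p11:
  fixes n :: nat and C :: "nat \<Rightarrow> nat \<Rightarrow> 'k::alg_closed_field"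
  assumes "n \<ge> 2" and "C \<in> diag_matrices (n - 1)"
  shows "affine_subvariety (n - 1) (cocycle_space n C) \<and>
         variety_dim (n - 1) (cocycle_space n C) \<le> enat (num_generic_components n C)"
  using affine_subvariety_cocycle_space[OF alg_closed_infinite] variety_dim_cocycle_space_le[OF assms(2)]
  by blast

end
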